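(* Let $\varrho$ be a state acting on the Hilbert space $\mathbb{C}^d\otimes\mathbb{C}^d$. Then $$\mathcal{M}(\varrho)\leq \log_2 d+\Big(1-\frac{1}{d}\Big)\log_2(d+1)-S(\varrho).$$
   Context: A state is a density matrix; $S(\varrho)=-\mathrm{Tr}\,\varrho\log_2\varrho$ is the von Neumann entropy. $\mathcal{PS}$ denotes the set of product states $\varrho_A\otimes\varrho_B$. A von Neumann measurement $\mathcal{P}=\{P_i\}$ is a complete family of mutually orthogonal rank-one projectors on $\mathbb{C}^d\otimes\mathbb{C}^d$ (not necessarily of product form) summing to the identity. The Klein entropy is $H(\varrho,\mathcal{P})=-\sum_i p_i\log_2 p_i$ with $p_i=\mathrm{Tr}(\varrho P_i)$ and $0\log_2 0=0$. The entropic entanglement parameter is $$\mathcal{M}(\varrho)=\sup_{\mathcal{P}}\Big(\inf_{\delta\in\mathcal{PS}}H(\delta,\mathcal{P})-H(\varrho,\mathcal{P})\Big),$$ the supremum being over all von Neumann measurements. *)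

theory Defs
  imports "HOL-Analysis.Analysis"
begin

definition cinner :: "complex ^ 'n \<Rightarrow> complex ^ 'n \<Rightarrow> complex" where
  "cinner x y = (\<Sum>i\<in>UNIV. cnj (x $ i) * y $ i)"

definition dagger :: "complex ^ 'n ^ 'm \<Rightarrow> complex ^ 'm ^ 'n" where
  "dagger A = (\<chi> i j. cnj (A $ j $ i))"

definition hermitian :: "complex ^ 'n ^ 'n \<Rightarrow> bool" where
  "hermitian A \<longleftrightarrow> dagger A = A"

definition unitary :: "complex ^ 'n ^ 'n \<Rightarrow> bool" where
  "unitary U \<longleftrightarrow> dagger U ** U = mat 1 \<and> U ** dagger U = mat 1"

definition pos_semidef :: "complex ^ 'n ^ 'n \<Rightarrow> bool" where
  "pos_semidef A \<longleftrightarrow> hermitian A \<and> (\<forall>x. 0 \<le> Re (cinner x (A *v x)))"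

definition density_matrix :: "complex ^ 'n ^ 'n \<Rightarrow> bool" where
  "density_matrix \<rho> \<longleftrightarrow> pos_semidef \<rho> \<and> trace \<rho> = 1"

definition diag_matrix :: "('n \<Rightarrow> real) \<Rightarrow> complex ^ 'n ^ 'n" where
  "diag_matrix l = (\<chi> i j. if i = j then complex_of_real (l i) else 0)"

(* Functional calculus for Hermitian matrices: B = f(A). The value B exists by the spectral
   theorem and does not depend on the diagonalisation, see fun_calculus_unique below. *)
definition is_fun_calculus :: "(real \<Rightarrow> real) \<Rightarrow> complex ^ 'n ^ 'n \<Rightarrow> complex ^ 'n ^ 'n \<Rightarrow> bool" where
  "is_fun_calculus f A B \<longleftrightarrow>
     (\<exists>U l. unitary U \<and> A = U ** diag_matrix l ** dagger U \<and>
            B = U ** diag_matrix (\<lambda>i. f (l i)) ** dagger U)"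

definition fun_calculus :: "(real \<Rightarrow> real) \<Rightarrow> complex ^ 'n ^ 'n \<Rightarrow> complex ^ 'n ^ 'n" where
  "fun_calculus f A = (THE B. is_fun_calculus f A B)"

lemma matrix_mul_diag_matrix: "(A ** diag_matrix l) $ i $ j = A $ i $ j * complex_of_real (l j)"
  by (simp add: matrix_matrix_mult_def diag_matrix_def if_distrib cong: if_cong)

lemma diag_matrix_mul_matrix: "(diag_matrix l ** A) $ i $ j = complex_of_real (l i) * A $ i $ j"
  by (simp add: matrix_matrix_mult_def diag_matrix_def if_distrib if_distribR cong: if_cong)

lemma fun_calculus_unique:
  assumes "is_fun_calculus f A B" and "is_fun_calculus f A C"
  shows "B = C"
proof -
  obtain U l where U: "unitary U" and AU: "A = U ** diag_matrix l ** dagger U"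
    and B: "B = U ** diag_matrix (\<lambda>i. f (l i)) ** dagger U"
    using assms(1) unfolding is_fun_calculus_def by blast
  obtain V m where V: "unitary V" and AV: "A = V ** diag_matrix m ** dagger V"
    and C: "C = V ** diag_matrix (\<lambda>i. f (m i)) ** dagger V"
    using assms(2) unfolding is_fun_calculus_def by blast
  define W where "W = dagger V ** U"
  have "dagger V ** (U ** diag_matrix l ** dagger U) ** U = dagger V ** (V ** diag_matrix m ** dagger V) ** U"
    using AU AV by simp
  moreover have "dagger V ** (U ** diag_matrix l ** dagger U) ** U = W ** diag_matrix l ** (dagger U ** U)"
    by (simp add: W_def matrix_mul_assoc)
  moreover have "dagger V ** (V ** diag_matrix m ** dagger V) ** U = (dagger V ** V) ** diag_matrix m ** W"
    by (simp add: W_def matrix_mul_assoc)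
  ultimately have eq: "W ** diag_matrix l = diag_matrix m ** W"
    using U V by (simp add: unitary_def)
  have entry: "W $ i $ j = 0 \<or> l j = m i" for i j
    using arg_cong[OF eq, of "\<lambda>X. X $ i $ j"]
    by (auto simp: matrix_mul_diag_matrix diag_matrix_mul_matrix)
  have "(W ** diag_matrix (\<lambda>i. f (l i))) $ i $ j = (diag_matrix (\<lambda>i. f (m i)) ** W) $ i $ j" for i j
    using entry[of i j] by (auto simp: matrix_mul_diag_matrix diag_matrix_mul_matrix)
  then have eqf: "W ** diag_matrix (\<lambda>i. f (l i)) = diag_matrix (\<lambda>i. f (m i)) ** W"
    by (simp add: vec_eq_iff)
  have "B = (V ** dagger V) ** U ** diag_matrix (\<lambda>i. f (l i)) ** dagger U"
    using V B by (simp add: unitary_def)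
  also have "\<dots> = V ** (W ** diag_matrix (\<lambda>i. f (l i))) ** dagger U"
    by (simp add: W_def matrix_mul_assoc)
  also have "\<dots> = V ** diag_matrix (\<lambda>i. f (m i)) ** dagger V ** (U ** dagger U)"
    by (simp only: eqf) (simp add: W_def matrix_mul_assoc)
  also have "\<dots> = C"
    using U C by (simp add: unitary_def)
  finally show ?thesis .
qed

(* 0 log 0 = 0 holds automatically below: log 2 0 = 0 in HOL, and any finite value of the
   logarithm at 0 would give the same result. *)
definition von_neumann_entropy :: "complex ^ 'n ^ 'n \<Rightarrow> real" where
  "von_neumann_entropy \<rho> = - Re (trace (\<rho> ** fun_calculus (log 2) \<rho>))"

definition tensor :: "complex ^ 'a ^ 'a \<Rightarrow> complex ^ 'b ^ 'b \<Rightarrow> complex ^ ('a \<times> 'b) ^ ('a \<times> 'b)" where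
  "tensor A B = (\<chi> i j. A $ fst i $ fst j * B $ snd i $ snd j)"

definition product_states :: "(complex ^ ('d::finite \<times> 'd) ^ ('d \<times> 'd)) set" where
  "product_states = {tensor \<rho>A \<rho>B | \<rho>A \<rho>B. density_matrix \<rho>A \<and> density_matrix \<rho>B}"

definition projector :: "complex ^ 'n ^ 'n \<Rightarrow> bool" where
  "projector P \<longleftrightarrow> hermitian P \<and> P ** P = P"

(* A family of projectors is represented by its set of members: mutually orthogonal rank-one
   projectors are pairwise distinct, so nothing is lost. *)
definition von_neumann_measurement :: "(complex ^ 'n ^ 'n) set \<Rightarrow> bool" where
  "von_neumann_measurement \<P> \<longleftrightarrow>
     finite \<P> \<and>
     (\<forall>P\<in>\<P>. projector P \<and> rank P = 1) \<and>
     (\<forall>P\<in>\<P>. \<forall>Q\<in>\<P>. P \<noteq> Q \<longrightarrow> P ** Q = 0) \<and>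
     (\<Sum>P\<in>\<P>. P) = mat 1"

definition klein_entropy :: "complex ^ 'n ^ 'n \<Rightarrow> (complex ^ 'n ^ 'n) set \<Rightarrow> real" where
  "klein_entropy \<rho> \<P> = - (\<Sum>P\<in>\<P>. let p = Re (trace (\<rho> ** P)) in p * log 2 p)"

(* The supremum and the infimum are over nonempty bounded sets of reals: for states, the Klein
   entropy of a d^2-outcome measurement lies between 0 and 2 log d. *)
definition entanglement_parameter :: "complex ^ ('d::finite \<times> 'd) ^ ('d \<times> 'd) \<Rightarrow> real" where
  "entanglement_parameter \<rho> =
     (SUP \<P> \<in> {\<P>. von_neumann_measurement \<P>}.
        (INF \<delta> \<in> product_states. klein_entropy \<delta> \<P>) - klein_entropy \<rho> \<P>)"

end

theory Submission
  imports Defs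
begin

text \<open>
  Two estimates hold for every measurement. First, the outcome distribution of \<open>\<rho>\<close> is the image
  of its spectrum under a doubly stochastic matrix, so the Klein entropy is at least
  \<open>S(\<rho>)\<close>. Secondly, for a projector \<open>P\<close> of the measurement some product state \<open>\<delta>\<close> satisfies
  \<open>Tr (\<delta> P) \<ge> 1/d\<close>: the \<open>d\<close> diagonal blocks of \<open>P\<close> have total trace \<open>1\<close>, so some block
  \<open>Q = (\<langle>k| \<otimes> I) P (|k\<rangle> \<otimes> I)\<close> has trace at least \<open>1/d\<close>, and
  \<open>\<delta> = |k\<rangle>\<langle>k| \<otimes> Q / Tr Q\<close> works because \<open>Q\<close> has rank one. The Gibbs inequality against the
  distribution with weight \<open>1/d\<close> at \<open>P\<close> and \<open>1/(d(d+1))\<close> at each of the other \<open>d\<^sup>2 - 1\<close>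
  projectors then bounds the Klein entropy of \<open>\<delta>\<close> by \<open>log d + (1 - 1/d) log (d+1)\<close>.
\<close>

subsection \<open>The spectral theorem for Hermitian matrices\<close>

lemma dagger_mul: "dagger (A ** B) = dagger B ** dagger A"
  by (simp add: dagger_def matrix_matrix_mult_def vec_eq_iff mult.commute)

lemma dagger_dagger [simp]: "dagger (dagger A) = A"
  by (simp add: dagger_def vec_eq_iff)

text \<open>This bridge lets \<open>complex ^ 'n\<close> be treated as a real Euclidean space, so
  that real compactness, orthogonality and dimension arguments apply to complex vectors.\<close>

lemma Re_cinner: "Re (cinner x y) = x \<bullet> y"
  by (simp add: cinner_def inner_vec_def inner_complex_def)

lemma cinner_self: "cinner x x = complex_of_real (x \<bullet> x)"
  by (simp add: complex_eq_iff Re_cinner) (simp add: cinner_def mult.commute)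

lemma cinner_commute: "cinner y x = cnj (cinner x y)"
  by (simp add: cinner_def mult.commute)

lemma cinner_scale_right: "cinner x (c *s y) = c * cinner x y"
  by (simp add: cinner_def sum_distrib_left mult_ac)

lemma cinner_matrix_left: "cinner (A *v x) y = cinner x (dagger A *v y)"
proof -
  have "cinner (A *v x) y = (\<Sum>i\<in>UNIV. \<Sum>j\<in>UNIV. cnj (A $ i $ j) * cnj (x $ j) * y $ i)"
    by (simp add: cinner_def matrix_vector_mult_def sum_distrib_right)
  also have "\<dots> = (\<Sum>j\<in>UNIV. \<Sum>i\<in>UNIV. cnj (A $ i $ j) * cnj (x $ j) * y $ i)"
    by (rule sum.swap)
  also have "\<dots> = cinner x (dagger A *v y)"
    by (simp add: cinner_def matrix_vector_mult_def dagger_def sum_distrib_left mult_ac)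
  finally show ?thesis .
qed

lemma cinner_zero_right [simp]: "cinner x 0 = 0"
  by (simp add: cinner_def)

lemma cinner_add_right: "cinner x (y + z) = cinner x y + cinner x z"
  by (simp add: cinner_def sum.distrib algebra_simps)

lemma scaleR_eq_vector_scalar: "r *\<^sub>R x = complex_of_real r *s x"
  by (simp add: vec_eq_iff complex_eq_iff)

lemma cinner_scaleR_right: "cinner x (r *\<^sub>R y) = complex_of_real r * cinner x y"
  by (simp add: scaleR_eq_vector_scalar cinner_scale_right)

lemma cinner_diff_right: "cinner x (y - z) = cinner x y - cinner x z"
  by (simp add: cinner_def sum_subtractf algebra_simps)

text \<open>A maximiser of the Rayleigh quotient is an eigenvector.\<close>

lemma self_adjoint_eigenvector:
  fixes f :: "'a::euclidean_space \<Rightarrow> 'a"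
  assumes "linear f" and adj: "\<And>x y. x \<bullet> f y = f x \<bullet> y"
    and S: "subspace S" "f ` S \<subseteq> S" "u \<in> S" "u \<noteq> 0"
  obtains v l where "v \<in> S" "norm v = 1" "f v = l *\<^sub>R v"
proof -
  interpret linear f by fact
  define K where "K = S \<inter> sphere 0 1"
  have "compact K"
    unfolding K_def using closed_subspace[OF S(1)] by (simp add: closed_Int_compact)
  moreover have "u /\<^sub>R norm u \<in> K"
    using S by (simp add: K_def subspace_mul)
  moreover have "continuous_on K (\<lambda>x. x \<bullet> f x)"
    by (intro continuous_intros linear_continuous_on linear_linear[THEN iffD2] \<open>linear f\<close>)
  ultimately obtain v where v: "v \<in> K" and max: "\<And>y. y \<in> K \<Longrightarrow> y \<bullet> f y \<le> v \<bullet> f v"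
    using continuous_attains_sup[of K "\<lambda>x. x \<bullet> f x"] by blast
  define l where "l = v \<bullet> f v"
  have vS: "v \<in> S" and nv: "norm v = 1" and vv: "v \<bullet> v = 1"
    using v by (auto simp: K_def norm_eq_1)
  \<comment> \<open>By homogeneity the maximum over the unit sphere of \<open>S\<close> controls the
    quadratic form on all of \<open>S\<close>.\<close>
  have le: "y \<bullet> f y \<le> l * (y \<bullet> y)" if "y \<in> S" for y
  proof (cases "y = 0")
    case False
    then have "(y /\<^sub>R norm y) \<bullet> f (y /\<^sub>R norm y) \<le> l"
      unfolding l_def using that S(1) by (intro max) (simp add: K_def subspace_mul)
    then have "(y \<bullet> f y) / (norm y)\<^sup>2 \<le> l"
      by (simp add: scale power2_eq_square field_simps)
    then show ?thesis
      using False by (simp add: field_simps dot_square_norm)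
  qed (simp add: zero)
  define w where "w = f v - l *\<^sub>R v"
  have wS: "w \<in> S"
    unfolding w_def using vS S(1,2) by (intro subspace_diff subspace_mul) auto
  define N where "N = w \<bullet> w"
  define c where "c = l * (w \<bullet> w) - w \<bullet> f w"
  have N: "N = w \<bullet> f v - l * (v \<bullet> w)"
    unfolding N_def by (subst (2) w_def) (simp add: inner_diff_right inner_commute)
  \<comment> \<open>First variation of the Rayleigh quotient at \<open>v\<close> in the direction of the residual \<open>w\<close>.\<close>
  have quad: "2 * t * N \<le> t\<^sup>2 * c" for t
  proof -
    have "(v + t *\<^sub>R w) \<bullet> f (v + t *\<^sub>R w) \<le> l * ((v + t *\<^sub>R w) \<bullet> (v + t *\<^sub>R w))"
      using vS wS S(1) by (intro le subspace_add subspace_mul)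
    moreover have "v \<bullet> f w = w \<bullet> f v"
      using adj by (simp add: inner_commute)
    ultimately show ?thesis
      unfolding N c_def
      by (simp add: add scale inner_add_left inner_add_right l_def[symmetric] vv inner_commute[of w v]
          algebra_simps power2_eq_square)
  qed
  have "N \<ge> 0" by (simp add: N_def)
  then have "c \<ge> 0" using quad[of 1] by simp
  \<comment> \<open>A term linear in \<open>t\<close> lies below a quadratic one, so a small
    \<open>t\<close> forces \<open>N = 0\<close>. The choice \<open>t = N / (c + 1)\<close>, with a
    denominator that is positive even for \<open>c = 0\<close>, gives
    \<open>N\<^sup>2 * (c + 2) \<le> 0\<close>.\<close>
  have "2 * N * N / (c + 1) \<le> N\<^sup>2 * c / (c + 1)\<^sup>2"
    using quad[of "N / (c + 1)"] by (simp add: power_divide mult_ac)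
  then have "2 * N\<^sup>2 * (c + 1) \<le> N\<^sup>2 * c"
    using \<open>c \<ge> 0\<close> by (simp add: divide_simps power2_eq_square split: if_splits)
  moreover have "N\<^sup>2 * c \<ge> 0" using \<open>c \<ge> 0\<close> by simp
  moreover have "2 * N\<^sup>2 * (c + 1) = 2 * (N\<^sup>2 * c) + 2 * N\<^sup>2" by (simp add: algebra_simps)
  ultimately have "N\<^sup>2 \<le> 0" by linarith
  then have "f v = l *\<^sub>R v"
    by (simp add: N_def w_def)
  with vS nv that show thesis by blast
qed

theorem spectral_hermitian:
  fixes A :: "complex ^ 'n ^ 'n"
  assumes "hermitian A"
  obtains U l where "unitary U" "A = U ** diag_matrix l ** dagger U"
proof -
  have dA: "dagger A = A" using assms by (simp add: hermitian_def)
  define ok where "ok E \<longleftrightarrow> finite E \<and> (\<forall>e\<in>E. \<exists>l::real. A *v e = complex_of_real l *s e) \<and>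
      (\<forall>e\<in>E. \<forall>f\<in>E. cinner e f = (if e = f then 1 else 0))" for E
  \<comment> \<open>A maximal orthonormal set of eigenvectors is a basis, since its orthogonal complement is invariant.\<close>
  have card_le: "card E \<le> DIM(complex^'n)" if "ok E" for E
  proof -
    \<comment> \<open>Complex orthonormality implies real orthogonality. The resulting real
      dimension bound is crude, but it makes a largest \<open>E\<close> exist; the exact cardinality
      is computed below.\<close>
    have "pairwise orthogonal E"
      using that unfolding pairwise_def orthogonal_def ok_def by (metis Re_cinner zero_complex.sel(1))
    moreover have "0 \<notin> E"
      using that unfolding ok_def by (metis cinner_zero_right zero_neq_one)
    ultimately show ?thesis
      using independent_bound pairwise_orthogonal_independent by blast
  qed
  have "ok {}" by (simp add: ok_def)
  then obtain E where E: "ok E" and Emax: "\<And>F. ok F \<Longrightarrow> card F \<le> card E"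
    using ex_has_greatest_nat[of ok "{}" card "Suc DIM(complex^'n)"] card_le le_imp_less_Suc by blast
  then have finE: "finite E" and eig: "\<And>e. e \<in> E \<Longrightarrow> \<exists>l::real. A *v e = complex_of_real l *s e"
    and orth: "\<And>e f. e \<in> E \<Longrightarrow> f \<in> E \<Longrightarrow> cinner e f = (if e = f then 1 else 0)"
    by (auto simp: ok_def)
  define S where "S = {x. \<forall>e\<in>E. cinner e x = 0}"
  have subS: "subspace S"
    by (auto simp: subspace_def S_def cinner_add_right cinner_scaleR_right)
  have invS: "(*v) A ` S \<subseteq> S"
  proof (clarsimp simp: S_def)
    fix x e assume "\<forall>e\<in>E. cinner e x = 0" "e \<in> E"
    moreover obtain l :: real where "A *v e = complex_of_real l *s e" using eig \<open>e \<in> E\<close> by blast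
    ultimately have "cinner x (A *v e) = 0"
      by (simp add: cinner_scale_right) (metis cinner_commute complex_cnj_zero)
    then show "cinner e (A *v x) = 0"
      by (metis cinner_matrix_left cinner_commute complex_cnj_zero dA)
  qed
  have S0: "x = 0" if "x \<in> S" for x
  proof (rule ccontr)
    assume "x \<noteq> 0"
    \<comment> \<open>Viewed over the reals, a Hermitian matrix is a symmetric linear map, so the
      eigenvalue obtained is real.\<close>
    have "linear ((*v) A)"
      by (rule linearI) (simp_all add: matrix_vector_right_distrib scaleR_eq_vector_scalar
          vec.scale)
    moreover have "x \<bullet> (A *v y) = (A *v x) \<bullet> y" for x y
      by (metis Re_cinner cinner_matrix_left dA)
    ultimately obtain v l where v: "v \<in> S" "norm v = 1" "A *v v = l *\<^sub>R v"
      using self_adjoint_eigenvector[OF _ _ subS invS \<open>x \<in> S\<close> \<open>x \<noteq> 0\<close>] by blast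
    have vv: "cinner v v = 1"
      using v(2) by (simp add: cinner_self norm_eq_1)
    have ve: "cinner e v = 0" "cinner v e = 0" if "e \<in> E" for e
      using v(1) that by (auto simp: S_def cinner_commute[of v])
    have "v \<notin> E" using ve vv by force
    have "ok (insert v E)"
      unfolding ok_def using finE eig orth ve vv v(3) \<open>v \<notin> E\<close>
      by (auto simp: scaleR_eq_vector_scalar)
    from Emax[OF this] show False using \<open>v \<notin> E\<close> finE by simp
  qed
  have expand: "x = (\<Sum>e\<in>E. cinner e x *s e)" for x
  proof -
    have sum_right: "cinner f (\<Sum>e\<in>F. c e *s e) = (\<Sum>e\<in>F. c e * cinner f e)" if "finite F" for f F and c :: "_ \<Rightarrow> complex"
      using that by (induction F) (simp_all add: cinner_add_right cinner_scale_right)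
    have "cinner f (x - (\<Sum>e\<in>E. cinner e x *s e)) = 0" if "f \<in> E" for f
      using that finE by (simp add: cinner_diff_right sum_right orth if_distrib cong: if_cong sum.cong)
    then have "x - (\<Sum>e\<in>E. cinner e x *s e) = 0"
      using S0 unfolding S_def by blast
    then show ?thesis by simp
  qed
  \<comment> \<open>The trace of the identity is evaluated twice: in the standard basis, and after
    expansion in \<open>E\<close>, where it becomes the sum of the squared norms of the members of
    \<open>E\<close>.\<close>
  have "card E = CARD('n)"
  proof -
    have "of_nat CARD('n) = (\<Sum>i\<in>(UNIV :: 'n set). axis i 1 $ i :: complex)"
      by simp
    also have "\<dots> = (\<Sum>i\<in>UNIV. \<Sum>e\<in>E. cinner e (axis i 1) * e $ i)"
      by (subst expand) simp
    also have "\<dots> = (\<Sum>i\<in>UNIV. \<Sum>e\<in>E. cnj (e $ i) * e $ i)"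
      by (simp add: cinner_def axis_def if_distrib cong: if_cong)
    also have "\<dots> = (\<Sum>e\<in>E. cinner e e)"
      by (subst sum.swap) (simp add: cinner_def)
    also have "\<dots> = of_nat (card E)"
      by (simp add: orth)
    finally show ?thesis by (simp only: of_nat_eq_iff)
  qed
  then obtain h where h: "bij_betw h (UNIV :: 'n set) E"
    using finE finite_same_card_bij by (metis finite)
  then have hE: "h i \<in> E" for i by (auto simp: bij_betw_def)
  have hinj: "h i = h j \<longleftrightarrow> i = j" for i j using h by (auto simp: bij_betw_def inj_on_def)
  have "\<forall>i. \<exists>l::real. A *v h i = complex_of_real l *s h i"
    using eig hE by blast
  from choice[OF this] obtain l where l: "\<And>i. A *v h i = complex_of_real (l i) *s h i"
    by blast
  define U where "U = (\<chi> i j. h j $ i)"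
  have "(dagger U ** U) $ i $ j = cinner (h i) (h j)" for i j
    by (simp add: U_def dagger_def matrix_matrix_mult_def cinner_def)
  then have "(dagger U ** U) $ i $ j = (if i = j then 1 else 0)" for i j
    using orth[OF hE hE] hinj by simp
  then have 1: "dagger U ** U = mat 1"
    by (simp add: vec_eq_iff mat_def)
  then have 2: "U ** dagger U = mat 1"
    using matrix_left_right_inverse by blast
  have "(A ** U) $ i $ j = (A *v h j) $ i" for i j
    by (simp add: U_def matrix_matrix_mult_def matrix_vector_mult_def)
  then have "A ** U = U ** diag_matrix l"
    by (simp add: vec_eq_iff matrix_mul_diag_matrix l) (simp add: U_def mult.commute)
  then have "A = U ** diag_matrix l ** dagger U"
    using 2 by (metis matrix_mul_assoc matrix_mul_rid)
  with 1 2 that show thesis by (simp add: unitary_def)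
qed

subsection \<open>Density matrices and projectors\<close>

text \<open>Cyclicity of the trace moves \<open>B\<close> into the basis formed by the columns of
  \<open>U\<close>, where only its diagonal meets the weights \<open>l\<close>.\<close>

lemma trace_diag_conj:
  fixes U :: "complex ^ 'n ^ 'n"
  shows "trace ((U ** diag_matrix l ** dagger U) ** B) =
    (\<Sum>j\<in>UNIV. complex_of_real (l j) * (dagger U ** B ** U) $ j $ j)"
proof -
  have "trace ((U ** diag_matrix l ** dagger U) ** B) = trace (U ** (diag_matrix l ** (dagger U ** B)))"
    by (simp add: matrix_mul_assoc)
  also have "\<dots> = trace (diag_matrix l ** (dagger U ** B ** U))"
    by (subst trace_mul_sym) (simp add: matrix_mul_assoc)
  also have "\<dots> = (\<Sum>j\<in>UNIV. complex_of_real (l j) * (dagger U ** B ** U) $ j $ j)"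
    by (simp add: trace_def diag_matrix_mul_matrix)
  finally show ?thesis .
qed

text \<open>By \<open>fun_calculus_unique\<close>, any diagonalisation of \<open>\<rho>\<close> may
  be used to evaluate the logarithm, and the entropy becomes the Shannon entropy of the
  spectrum.\<close>

lemma von_neumann_entropy_diagonalised:
  fixes U :: "complex ^ 'n ^ 'n"
  assumes U: "unitary U" and \<rho>: "\<rho> = U ** diag_matrix l ** dagger U"
  shows "von_neumann_entropy \<rho> = - (\<Sum>j\<in>UNIV. l j * log 2 (l j))"
proof -
  have "is_fun_calculus (log 2) \<rho> (U ** diag_matrix (\<lambda>i. log 2 (l i)) ** dagger U)"
    using U \<rho> by (auto simp: is_fun_calculus_def)
  then have "fun_calculus (log 2) \<rho> = U ** diag_matrix (\<lambda>i. log 2 (l i)) ** dagger U"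
    unfolding fun_calculus_def using fun_calculus_unique by blast
  moreover have "dagger U ** (U ** diag_matrix (\<lambda>i. log 2 (l i)) ** dagger U) ** U = diag_matrix (\<lambda>i. log 2 (l i))"
    using U by (metis unitary_def matrix_mul_assoc matrix_mul_lid matrix_mul_rid)
  ultimately have "trace (\<rho> ** fun_calculus (log 2) \<rho>) = (\<Sum>j\<in>UNIV. complex_of_real (l j * log 2 (l j)))"
    unfolding \<rho> by (simp add: trace_diag_conj) (simp add: diag_matrix_def)
  then show ?thesis
    by (simp add: von_neumann_entropy_def)
qed

lemma cinner_axis_left: "cinner (axis i 1) x = x $ i"
  by (simp add: cinner_def axis_def if_distrib[of cnj] if_distrib[of "\<lambda>c. c * _"] cong: if_cong)

lemma matrix_vector_mult_axis:
  fixes A :: "'a::semiring_1 ^ 'n ^ 'm"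
  shows "(A *v axis j 1) $ i = A $ i $ j"
  by (simp add: matrix_vector_mult_def axis_def if_distrib cong: if_cong)

lemma gram_diag:
  "(dagger C ** C) $ i $ i = complex_of_real (\<Sum>k\<in>UNIV. (cmod (C $ k $ i))\<^sup>2)"
  by (simp add: matrix_matrix_mult_def dagger_def complex_norm_square mult.commute del: of_real_power)

lemma pos_semidef_gram: "pos_semidef (dagger C ** C)"
proof -
  have "cinner x (dagger C ** C *v x) = cinner (C *v x) (C *v x)" for x
    by (metis cinner_matrix_left matrix_vector_mul_assoc)
  then show ?thesis
    by (simp add: pos_semidef_def hermitian_def dagger_mul Re_cinner)
qed

text \<open>Positivity of projectors enters through this Gram form: it makes the diagonal entries of
  \<open>P\<close> and of its unitary conjugates real and nonnegative.\<close>

lemma projector_eq_gram: "projector P \<Longrightarrow> P = dagger P ** P"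
  by (simp add: projector_def hermitian_def)

lemma density_matrix_diagonalisation:
  fixes \<rho> :: "complex ^ 'n ^ 'n"
  assumes "density_matrix \<rho>"
  obtains U l where "unitary U" "\<rho> = U ** diag_matrix l ** dagger U" "\<And>j. 0 \<le> l j" "(\<Sum>j\<in>UNIV. l j) = 1"
proof -
  obtain U l where U: "unitary U" and \<rho>: "\<rho> = U ** diag_matrix l ** dagger U"
    using spectral_hermitian assms unfolding density_matrix_def pos_semidef_def by blast
  have D: "dagger U ** \<rho> ** U = diag_matrix l"
    unfolding \<rho> using U by (metis unitary_def matrix_mul_assoc matrix_mul_lid matrix_mul_rid)
  \<comment> \<open>Each eigenvalue is the quadratic form of \<open>\<rho>\<close> at a column of
    \<open>U\<close>, hence nonnegative.\<close>
  have "complex_of_real (l j) = cinner (U *v axis j 1) (\<rho> *v (U *v axis j 1))" for j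
  proof -
    have "complex_of_real (l j) = cinner (axis j 1) (diag_matrix l *v axis j 1)"
      by (simp add: cinner_axis_left matrix_vector_mult_axis diag_matrix_def)
    also have "\<dots> = cinner (axis j 1) (dagger U *v (\<rho> *v (U *v axis j 1)))"
      by (simp only: D[symmetric] matrix_vector_mul_assoc matrix_mul_assoc)
    finally show ?thesis
      by (simp only: cinner_matrix_left)
  qed
  then have "0 \<le> l j" for j
    using assms unfolding density_matrix_def pos_semidef_def by (metis Re_complex_of_real)
  moreover have "complex_of_real (\<Sum>j\<in>UNIV. l j) = trace \<rho>"
    using trace_diag_conj[of U l "mat 1"] U \<rho> by (simp add: unitary_def) (simp add: mat_def)
  then have "(\<Sum>j\<in>UNIV. l j) = 1"
    using assms by (simp add: density_matrix_def) (metis of_real_eq_1_iff of_real_sum)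
  ultimately show thesis using U \<rho> that by blast
qed

text \<open>The factor is the square root of the spectrum times \<open>dagger U\<close>. Gram
  factors can be tensored, which yields positivity of product states.\<close>

lemma density_matrix_gram:
  fixes A :: "complex ^ 'n ^ 'n"
  assumes "density_matrix A"
  obtains C :: "complex ^ 'n ^ 'n" where "A = dagger C ** C"
proof -
  obtain U :: "complex ^ 'n ^ 'n" and l where A: "A = U ** diag_matrix l ** dagger U" and l: "\<And>j. 0 \<le> l j"
    using density_matrix_diagonalisation[OF assms] by metis
  let ?R = "diag_matrix (\<lambda>j. sqrt (l j))"
  have "diag_matrix l = dagger ?R ** ?R"
    using l by (simp add: vec_eq_iff matrix_mul_diag_matrix)
      (simp add: dagger_def diag_matrix_def flip: of_real_mult)
  then have "A = dagger (?R ** dagger U) ** (?R ** dagger U)"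
    by (simp add: A dagger_mul matrix_mul_assoc)
  then show thesis by (rule that)
qed

section \<open>Tensor products of density matrices\<close>

lemma dagger_tensor: "dagger (tensor A B) = tensor (dagger A) (dagger B)"
  by (simp add: dagger_def tensor_def)

lemma tensor_mul: "tensor A B ** tensor C D = tensor (A ** C) (B ** D)"
  by (simp add: vec_eq_iff tensor_def matrix_matrix_mult_def sum_product sum.cartesian_product
      case_prod_unfold mult_ac)

lemma trace_tensor: "trace (tensor A B) = trace A * trace B"
  by (simp add: trace_def tensor_def sum_product sum.cartesian_product case_prod_unfold)

lemma density_matrix_tensor:
  fixes A :: "complex ^ 'a ^ 'a" and B :: "complex ^ 'b ^ 'b"
  assumes "density_matrix A" "density_matrix B"
  shows "density_matrix (tensor A B)"
proof -
  obtain C :: "complex ^ 'a ^ 'a" where "A = dagger C ** C"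
    using density_matrix_gram[OF assms(1)] .
  moreover obtain D :: "complex ^ 'b ^ 'b" where "B = dagger D ** D"
    using density_matrix_gram[OF assms(2)] .
  ultimately have "tensor A B = dagger (tensor C D) ** tensor C D"
    by (simp add: dagger_tensor tensor_mul)
  then have "pos_semidef (tensor A B)"
    by (simp add: pos_semidef_gram)
  then show ?thesis
    using assms by (simp add: density_matrix_def trace_tensor)
qed

text \<open>All rows are multiples of one spanning vector, so the entries factor. The factorisation
  turns \<open>P ** P = P\<close> into \<open>P = trace P *s P\<close> entrywise, and
  \<open>P\<close> is nonzero.\<close>

lemma rank_one_projector_outer:
  fixes P :: "complex ^ 'n ^ 'n"
  assumes "projector P" "rank P = 1"
  obtains c b where "\<And>i j. P $ i $ j = c i * b j" "trace P = 1"
proof -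
  obtain B where B: "B \<subseteq> rows P" "rows P \<subseteq> vec.span B" "card B = 1" "vec.independent B"
    using vec.basis_exists[of "rows P"] assms(2) by (metis row_rank_def_gen)
  then obtain b where "B = {b}" by (auto simp: card_1_singleton_iff)
  then have "\<exists>k. row i P = k *s b" for i
    using B(2) by (auto simp: vec.span_singleton rows_def)
  then obtain c where "\<And>i. row i P = c i *s b" by metis
  then have P: "P $ i $ j = c i * b $ j" for i j
    by (metis row_def vec_lambda_beta vector_smult_component vec_nth_inverse)
  have "P \<noteq> 0"
  proof
    assume "P = 0"
    then have "b = 0" using \<open>B = {b}\<close> B(1) by (auto simp: rows_def row_def vec_eq_iff)
    then show False using B(4) \<open>B = {b}\<close> vec.dependent_zero by blast
  qed
  then obtain i j where ij: "P $ i $ j \<noteq> 0" by (auto simp: vec_eq_iff)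
  have "P $ i $ j = (P ** P) $ i $ j" using assms by (simp add: projector_def)
  also have "\<dots> = c i * b $ j * trace P"
    by (simp add: matrix_matrix_mult_def trace_def P sum_distrib_left mult_ac)
  finally have "trace P = 1" using ij by (simp add: P)
  with P that[of c "($) b"] show thesis by blast
qed

subsection \<open>Entropy bounds for measurements\<close>

text \<open>This is the tangent bound \<open>ln t \<le> t - 1\<close> at \<open>t = y / x\<close>.
  The last hypothesis excludes \<open>y = 0 < x\<close>, where the value \<open>log 2 0 = 0\<close>
  can break it.\<close>

lemma mult_log_le:
  fixes x y :: real
  assumes "0 \<le> x" "0 \<le> y" "y = 0 \<Longrightarrow> x = 0"
  shows "x * log 2 y \<le> x * log 2 x + (y - x) / ln 2"
proof (cases "x = 0")
  case False
  then have pos: "0 < x" "0 < y" using assms by (auto simp: less_le)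
  then have "x * (ln y - ln x) \<le> y - x"
    using ln_diff_le[of y x] by (simp add: field_simps)
  then have "x * (ln y - ln x) / ln 2 \<le> (y - x) / ln 2"
    by (intro divide_right_mono) auto
  then show ?thesis
    by (simp add: log_def diff_divide_distrib right_diff_distrib)
qed (use assms in simp)

text \<open>The linear corrections from \<open>mult_log_le\<close> add up to
  \<open>(sum q I - sum p I) / ln 2\<close>, which is at most zero.\<close>

lemma gibbs_inequality:
  fixes p q :: "'a \<Rightarrow> real"
  assumes "\<And>i. i \<in> I \<Longrightarrow> 0 \<le> p i" "\<And>i. i \<in> I \<Longrightarrow> 0 < q i" "sum q I \<le> sum p I"
  shows "(\<Sum>i\<in>I. p i * log 2 (q i)) \<le> (\<Sum>i\<in>I. p i * log 2 (p i))"
proof -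
  have "(\<Sum>i\<in>I. p i * log 2 (q i)) \<le> (\<Sum>i\<in>I. p i * log 2 (p i) + (q i - p i) / ln 2)"
    using assms by (intro sum_mono mult_log_le) (auto simp: less_le)
  also have "\<dots> = (\<Sum>i\<in>I. p i * log 2 (p i)) + (sum q I - sum p I) / ln 2"
    by (simp add: sum.distrib sum_subtractf flip: sum_divide_distrib)
  also have "\<dots> \<le> (\<Sum>i\<in>I. p i * log 2 (p i))"
    using assms(3) by (simp add: divide_nonpos_pos)
  finally show ?thesis .
qed

text \<open>Convexity of \<open>x * log 2 x\<close> in tangent form: \<open>mult_log_le\<close>
  compares \<open>l j\<close> with \<open>p i\<close>, weighted by \<open>w i j\<close>. The
  corrections cancel in each row because the row sums are one; unit column sums then collapse the
  total.\<close>

lemma doubly_stochastic_entropy: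
  fixes w :: "'a \<Rightarrow> 'b \<Rightarrow> real"
  assumes w: "\<And>i j. i \<in> I \<Longrightarrow> j \<in> J \<Longrightarrow> 0 \<le> w i j"
    and fin: "finite J"
    and rows: "\<And>i. i \<in> I \<Longrightarrow> (\<Sum>j\<in>J. w i j) = 1"
    and cols: "\<And>j. j \<in> J \<Longrightarrow> (\<Sum>i\<in>I. w i j) = 1"
    and l: "\<And>j. j \<in> J \<Longrightarrow> 0 \<le> l j"
    and p: "\<And>i. i \<in> I \<Longrightarrow> p i = (\<Sum>j\<in>J. l j * w i j)"
  shows "(\<Sum>i\<in>I. p i * log 2 (p i)) \<le> (\<Sum>j\<in>J. l j * log 2 (l j))"
proof -
  have col: "(\<Sum>i\<in>I. \<Sum>j\<in>J. g j * w i j) = sum g J" for g :: "'b \<Rightarrow> real"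
    by (subst sum.swap) (simp add: cols flip: sum_distrib_left)
  have "p i * log 2 (p i) \<le> (\<Sum>j\<in>J. l j * log 2 (l j) * w i j)" if i: "i \<in> I" for i
  proof -
    have p0: "0 \<le> p i" using i w l p by (simp add: sum_nonneg)
    have "p i * log 2 (p i) = (\<Sum>j\<in>J. w i j * (l j * log 2 (p i)))"
      using p[OF i] by (simp add: sum_distrib_left sum_distrib_right mult_ac)
    also have "\<dots> \<le> (\<Sum>j\<in>J. w i j * (l j * log 2 (l j) + (p i - l j) / ln 2))"
    proof (rule sum_mono)
      fix j assume j: "j \<in> J"
      show "w i j * (l j * log 2 (p i)) \<le> w i j * (l j * log 2 (l j) + (p i - l j) / ln 2)"
      proof (cases "w i j = 0")
        case False
        \<comment> \<open>Since \<open>p i\<close> dominates each of its summands,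
          \<open>p i = 0\<close> forces \<open>l j = 0\<close> where the weight is positive: the
          side condition of \<open>mult_log_le\<close>.\<close>
        have "l j * w i j \<le> p i"
          using p[OF i] member_le_sum[of j J "\<lambda>j. l j * w i j"] fin i j w l by simp
        then have "p i = 0 \<Longrightarrow> l j = 0"
          using False w[OF i j] l[OF j] by (simp add: mult_le_0_iff)
        then show ?thesis
          using w[OF i j] l[OF j] p0 by (intro mult_left_mono mult_log_le)
      qed simp
    qed
    also have "\<dots> = (\<Sum>j\<in>J. l j * log 2 (l j) * w i j + (p i * w i j - l j * w i j) / ln 2)"
      by (intro sum.cong) (auto simp: algebra_simps diff_divide_distrib)
    also have "\<dots> = (\<Sum>j\<in>J. l j * log 2 (l j) * w i j)"
      using p[OF i] rows[OF i]
      by (simp add: sum.distrib sum_subtractf flip: sum_divide_distrib sum_distrib_left)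
    finally show ?thesis .
  qed
  then have "(\<Sum>i\<in>I. p i * log 2 (p i)) \<le> (\<Sum>i\<in>I. \<Sum>j\<in>J. l j * log 2 (l j) * w i j)"
    by (intro sum_mono) simp
  then show ?thesis by (simp add: col)
qed

section \<open>Outcome statistics of a measurement\<close>

lemma trace_sum: "trace (\<Sum>P\<in>S. f P) = (\<Sum>P\<in>S. trace (f P))"
  by (simp add: trace_def sum_component sum.swap[of _ S])

lemma matrix_mul_sum_right:
  fixes A :: "complex ^ 'n ^ 'm"
  shows "A ** (\<Sum>P\<in>S. f P) = (\<Sum>P\<in>S. A ** f P)"
  by (simp add: vec_eq_iff matrix_matrix_mult_def sum_component sum_distrib_left sum.swap[of _ S])

lemma matrix_mul_sum_left:
  fixes A :: "complex ^ 'n ^ 'm"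
  shows "(\<Sum>P\<in>S. f P) ** A = (\<Sum>P\<in>S. f P ** A)"
  by (simp add: vec_eq_iff matrix_matrix_mult_def sum_component sum_distrib_right sum.swap[of _ S])

lemma measurement_sum_trace:
  assumes "von_neumann_measurement M"
  shows "(\<Sum>P\<in>M. trace (A ** P)) = trace A"
  using assms by (simp add: von_neumann_measurement_def flip: trace_sum matrix_mul_sum_right)

lemma measurement_trace_one:
  assumes "von_neumann_measurement M" "P \<in> M"
  shows "trace P = 1"
  using assms unfolding von_neumann_measurement_def by (meson rank_one_projector_outer)

text \<open>Compare traces in the completeness relation: every projector contributes one.\<close>

lemma card_measurement:
  fixes M :: "(complex ^ 'n ^ 'n) set"
  assumes "von_neumann_measurement M"
  shows "card M = CARD('n)"
proof -
  have "of_nat (card M) = (\<Sum>P\<in>M. trace (mat 1 ** P))"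
    using measurement_trace_one[OF assms] by simp
  also have "\<dots> = of_nat CARD('n)"
    unfolding measurement_sum_trace[OF assms] by (simp add: trace_I)
  finally show ?thesis by (simp only: of_nat_eq_iff)
qed

text \<open>\<open>w P j\<close> is the expectation of \<open>P\<close> in the \<open>j\<close>-th
  column of \<open>U\<close>. Positivity, unit trace and completeness of the projectors make
  \<open>w\<close> doubly stochastic.\<close>

lemma measurement_overlaps:
  fixes M :: "(complex ^ 'n ^ 'n) set"
  assumes M: "von_neumann_measurement M" and U: "unitary U"
  defines "w \<equiv> \<lambda>P j. Re ((dagger U ** P ** U) $ j $ j)"
  shows "P \<in> M \<Longrightarrow> 0 \<le> w P j"
    and "P \<in> M \<Longrightarrow> (\<Sum>j\<in>UNIV. w P j) = 1"
    and "(\<Sum>P\<in>M. w P j) = 1"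
proof -
  assume P: "P \<in> M"
  then have "P = dagger P ** P"
    using M projector_eq_gram by (auto simp: von_neumann_measurement_def)
  then have "dagger U ** P ** U = dagger (P ** U) ** (P ** U)"
    by (metis dagger_mul matrix_mul_assoc)
  then show "0 \<le> w P j" by (simp add: w_def gram_diag sum_nonneg del: of_real_sum)
  have "trace (dagger U ** P ** U) = trace P"
    using U by (subst trace_mul_sym) (simp add: unitary_def matrix_mul_assoc)
  then show "(\<Sum>j\<in>UNIV. w P j) = 1"
    using measurement_trace_one[OF M P] by (simp add: w_def trace_def flip: Re_sum)
next
  have "(\<Sum>P\<in>M. dagger U ** P ** U) = dagger U ** (\<Sum>P\<in>M. P) ** U"
    by (simp add: matrix_mul_sum_left matrix_mul_sum_right)
  also have "\<dots> = mat 1" using M U by (simp add: von_neumann_measurement_def unitary_def)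
  finally have "(\<Sum>P\<in>M. dagger U ** P ** U) $ j $ j = 1"
    by (simp add: mat_def)
  then show "(\<Sum>P\<in>M. w P j) = 1"
    by (simp add: w_def sum_component flip: Re_sum)
qed

lemma measurement_prob:
  fixes U :: "complex ^ 'n ^ 'n"
  assumes "\<rho> = U ** diag_matrix l ** dagger U"
  shows "Re (trace (\<rho> ** P)) = (\<Sum>j\<in>UNIV. l j * Re ((dagger U ** P ** U) $ j $ j))"
  by (simp add: assms trace_diag_conj)

lemma von_neumann_entropy_le_klein:
  fixes \<rho> :: "complex ^ 'n ^ 'n"
  assumes "density_matrix \<rho>" "von_neumann_measurement M"
  shows "von_neumann_entropy \<rho> \<le> klein_entropy \<rho> M"
proof -
  obtain U l where U: "unitary U" and \<rho>: "\<rho> = U ** diag_matrix l ** dagger U" and l: "\<And>j. 0 \<le> l j"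
    using density_matrix_diagonalisation[OF assms(1)] by metis
  have "(\<Sum>P\<in>M. Re (trace (\<rho> ** P)) * log 2 (Re (trace (\<rho> ** P)))) \<le> (\<Sum>j\<in>UNIV. l j * log 2 (l j))"
    by (rule doubly_stochastic_entropy[where w = "\<lambda>P j. Re ((dagger U ** P ** U) $ j $ j)"])
      (use measurement_overlaps[OF assms(2) U] l measurement_prob[OF \<rho>] in auto)
  then show ?thesis
    by (simp add: von_neumann_entropy_diagonalised[OF U \<rho>] klein_entropy_def Let_def)
qed

lemma measurement_prob_nonneg:
  assumes "density_matrix \<rho>" "von_neumann_measurement M" "P \<in> M"
  shows "0 \<le> Re (trace (\<rho> ** P))"
proof -
  obtain U l where U: "unitary U" and \<rho>: "\<rho> = U ** diag_matrix l ** dagger U" and l: "\<And>j. 0 \<le> l j"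
    using density_matrix_diagonalisation[OF assms(1)] by metis
  show ?thesis
    using measurement_overlaps(1)[OF assms(2) U assms(3)] l
    by (simp add: measurement_prob[OF \<rho>] sum_nonneg)
qed

text \<open>Probabilities lie in \<open>[0, 1]\<close>, so every \<open>p * log 2 p\<close> is at
  most zero. This bounds the infimum over product states from below.\<close>

lemma klein_entropy_nonneg:
  assumes "density_matrix \<rho>" "von_neumann_measurement M"
  shows "0 \<le> klein_entropy \<rho> M"
proof -
  let ?p = "\<lambda>P. Re (trace (\<rho> ** P))"
  have sum1: "(\<Sum>P\<in>M. ?p P) = 1"
    using measurement_sum_trace[OF assms(2), of \<rho>] assms(1)
    by (simp add: density_matrix_def flip: Re_sum)
  have "?p P * log 2 (?p P) \<le> 0" if "P \<in> M" for P
  proof -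
    have "0 \<le> ?p P" using measurement_prob_nonneg[OF assms that] .
    moreover have "?p P \<le> 1"
      using member_le_sum[of P M ?p] measurement_prob_nonneg[OF assms] that sum1 assms(2)
      by (auto simp: von_neumann_measurement_def)
    ultimately show ?thesis
      by (cases "?p P = 0") (auto intro!: mult_nonneg_nonpos)
  qed
  then have "(\<Sum>P\<in>M. ?p P * log 2 (?p P)) \<le> 0" by (rule sum_nonpos)
  then show ?thesis by (simp add: klein_entropy_def Let_def)
qed

lemma klein_entropy_le_of_prob:
  assumes \<rho>: "density_matrix \<rho>" and M: "von_neumann_measurement M" and card: "card M = d * d"
    and Q: "Q \<in> M" and ge: "1 / real d \<le> Re (trace (\<rho> ** Q))"
  shows "klein_entropy \<rho> M \<le> log 2 (real d) + (1 - 1 / real d) * log 2 (real d + 1)"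
proof -
  let ?p = "\<lambda>P. Re (trace (\<rho> ** P))"
  \<comment> \<open>The mass \<open>(d - 1) / d\<close> left over by \<open>Q\<close> is spread
    evenly over the other \<open>d * d - 1 = (d - 1) * (d + 1)\<close> outcomes.\<close>
  define q where "q P = (if P = Q then 1 / real d else 1 / (real d * (real d + 1)))" for P
  have finM: "finite M" using M by (simp add: von_neumann_measurement_def)
  have d: "d > 0" using card Q finM by (cases d) auto
  have sum1: "(\<Sum>P\<in>M. ?p P) = 1"
    using measurement_sum_trace[OF M, of \<rho>] \<rho>
    by (simp add: density_matrix_def flip: Re_sum)
  have split: "(\<Sum>P\<in>M. f P) = f Q + (\<Sum>P\<in>M - {Q}. f P)" for f :: "_ \<Rightarrow> real"
    using finM Q by (rule sum.remove)
  have "(\<Sum>P\<in>M. q P) = 1 / real d + real (d * d - 1) / (real d * (real d + 1))"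
    using card finM Q by (simp add: split q_def)
  also have "real (d * d - 1) = (real d - 1) * (real d + 1)"
    using d by (simp add: of_nat_diff algebra_simps Suc_leI)
  also have "(real d - 1) * (real d + 1) / (real d * (real d + 1)) = (real d - 1) / real d"
    by simp
  also have "1 / real d + (real d - 1) / real d = 1"
    using d by (simp flip: add_divide_distrib)
  finally have "(\<Sum>P\<in>M. ?p P * log 2 (q P)) \<le> (\<Sum>P\<in>M. ?p P * log 2 (?p P))"
    using d sum1 by (intro gibbs_inequality measurement_prob_nonneg[OF \<rho> M]) (auto simp: q_def)
  then have "klein_entropy \<rho> M \<le> - (\<Sum>P\<in>M. ?p P * log 2 (q P))"
    by (simp add: klein_entropy_def Let_def)
  also have "\<dots> = ?p Q * (- log 2 (q Q)) + (\<Sum>P\<in>M - {Q}. ?p P * (- log 2 (q P)))"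
    by (simp add: split sum_negf)
  also have "\<dots> = ?p Q * log 2 (real d) + (\<Sum>P\<in>M - {Q}. ?p P * (log 2 (real d) + log 2 (real d + 1)))"
    using d by (simp add: q_def log_divide log_mult_pos add.commute)
  also have "\<dots> = ?p Q * log 2 (real d) + (\<Sum>P\<in>M - {Q}. ?p P) * (log 2 (real d) + log 2 (real d + 1))"
    by (simp only: sum_distrib_right)
  also have "(\<Sum>P\<in>M - {Q}. ?p P) = 1 - ?p Q"
    using split[of ?p] sum1 by simp
  also have "?p Q * log 2 (real d) + (1 - ?p Q) * (log 2 (real d) + log 2 (real d + 1)) =
      log 2 (real d) + (1 - ?p Q) * log 2 (real d + 1)"
    by (simp add: algebra_simps)
  \<comment> \<open>The expression decreases in \<open>?p Q\<close>, because
    \<open>log 2 (d + 1)\<close> is nonnegative.\<close>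
  also have "\<dots> \<le> log 2 (real d) + (1 - 1 / real d) * log 2 (real d + 1)"
    using ge d by (intro add_left_mono mult_right_mono) auto
  finally show ?thesis .
qed

lemma measurement_nonempty:
  assumes "von_neumann_measurement M"
  obtains P where "P \<in> M"
  using assms card_measurement[OF assms] by (metis card.empty zero_less_card_finite less_irrefl ex_in_conv)

text \<open>The projectors onto the standard basis vectors form a measurement, so the supremum
  ranges over a nonempty set.\<close>

lemma exists_measurement: "\<exists>M :: (complex ^ 'n ^ 'n) set. von_neumann_measurement M"
proof -
  define E :: "'n \<Rightarrow> complex ^ 'n ^ 'n" where "E k = diag_matrix (\<lambda>i. if i = k then 1 else 0)" for k
  have inj: "inj E"
  proof (rule injI)
    fix k m assume "E k = E m"
    then have "E k $ k $ k = E m $ k $ k" by simp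
    then show "k = m" by (simp add: E_def diag_matrix_def split: if_splits)
  qed
  have mult: "E k ** E m = (if k = m then E k else 0)" for k m
    unfolding E_def vec_eq_iff matrix_mul_diag_matrix by (auto simp: diag_matrix_def)
  have "hermitian (E k)" for k
    by (auto simp: hermitian_def dagger_def E_def diag_matrix_def vec_eq_iff)
  then have proj: "projector (E k)" for k
    by (simp add: projector_def mult)
  have rank: "rank (E k) = 1" for k
  proof -
    have row: "row i (E k) = (if i = k then axis k 1 else 0)" for i
      by (auto simp: row_def E_def diag_matrix_def vec_eq_iff axis_def)
    \<comment> \<open>Zero is inserted on both sides because \<open>E k\<close> has no zero row when
      the index type has a single element.\<close>
    then have "insert 0 (rows (E k)) = insert 0 {axis k 1}"
      by (auto simp: rows_def)
    then have "vec.span (rows (E k)) = vec.span {axis k 1}"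
      by (metis vec.span_insert_0)
    then show ?thesis
      unfolding row_rank_def_gen by (metis vec.dim_span vec.dim_singleton axis_eq_0_iff zero_neq_one)
  qed
  have "(\<Sum>P\<in>range E. P) = (\<Sum>k\<in>UNIV. E k)"
    using inj by (simp add: sum.reindex)
  also have "\<dots> = mat 1"
    by (auto simp: vec_eq_iff sum_component E_def diag_matrix_def mat_def
        if_distrib[of complex_of_real] cong: if_cong)
  finally have "von_neumann_measurement (range E)"
    unfolding von_neumann_measurement_def using proj rank mult by auto
  then show ?thesis ..
qed

subsection \<open>Product states with large overlap\<close>

lemma sum_UNIV_prod: "(\<Sum>i\<in>(UNIV :: ('a::finite \<times> 'b::finite) set). f i) = (\<Sum>a\<in>UNIV. \<Sum>b\<in>UNIV. f (a, b))"
  by (simp add: sum.cartesian_product flip: UNIV_Times_UNIV)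

lemma product_state_overlap:
  fixes P :: "complex ^ ('d::finite \<times> 'd) ^ ('d \<times> 'd)"
  assumes proj: "projector P" and rank: "rank P = 1"
  obtains \<delta> where "\<delta> \<in> product_states" "1 / real CARD('d) \<le> Re (trace (\<delta> ** P))"
proof -
  obtain c b where P: "\<And>i j. P $ i $ j = c i * b j" and tr: "trace P = 1"
    using rank_one_projector_outer[OF assms] by metis
  have gram: "P = dagger P ** P" using projector_eq_gram[OF proj] .
  define t where "t k = (\<Sum>l\<in>UNIV. Re (P $ (k, l) $ (k, l)))" for k
  have "(\<Sum>k\<in>UNIV. t k) = Re (trace P)"
    by (simp add: t_def trace_def sum_UNIV_prod)
  then have sum_t: "(\<Sum>k\<in>UNIV. t k) = 1" by (simp add: tr)
  obtain k where k: "1 / real CARD('d) \<le> t k"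
  proof (rule ccontr)
    assume "\<not> thesis"
    then have "t k < 1 / real CARD('d)" for k using that by (meson not_le)
    then have "(\<Sum>k\<in>UNIV. t k) < (\<Sum>k\<in>(UNIV :: 'd set). 1 / real CARD('d))"
      by (intro sum_strict_mono) auto
    then show False by (simp add: sum_t)
  qed
  have "0 < 1 / real CARD('d)" by simp
  with k have t0: "0 < t k" by linarith
  \<comment> \<open>The diagonal of the Gram matrix \<open>P\<close> is real, so \<open>t k\<close>
    is the full complex trace of block \<open>k\<close>.\<close>
  have T: "(\<Sum>l\<in>UNIV. P $ (k, l) $ (k, l)) = complex_of_real (t k)"
  proof -
    have "P $ i $ i = complex_of_real (Re (P $ i $ i))" for i
      by (subst (1 2) gram) (simp only: gram_diag Re_complex_of_real)
    then show ?thesis unfolding t_def of_real_sum by (intro sum.cong) auto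
  qed
  define \<alpha> :: "complex ^ 'd ^ 'd" where "\<alpha> = diag_matrix (\<lambda>i. if i = k then 1 else 0)"
  \<comment> \<open>\<open>C\<close> consists of the columns of \<open>P\<close> belonging to block
    \<open>k\<close>, scaled so that \<open>dagger C ** C\<close> is that block of
    \<open>dagger P ** P = P\<close> divided by its trace. The block is thereby seen to be a
    state.\<close>
  define C where "C = (\<chi> i l. P $ i $ (k, l) / complex_of_real (sqrt (t k)))"
  define \<sigma> where "\<sigma> = dagger C ** C"
  have \<sigma>: "\<sigma> $ l $ m = P $ (k, l) $ (k, m) / complex_of_real (t k)" for l m
  proof -
    have "\<sigma> $ l $ m = (dagger P ** P) $ (k, l) $ (k, m) / complex_of_real (sqrt (t k) * sqrt (t k))"
      unfolding \<sigma>_def C_def dagger_def matrix_matrix_mult_def by (simp add: sum_divide_distrib del: real_sqrt_mult_self)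
    also have "sqrt (t k) * sqrt (t k) = t k" using t0 by simp
    finally show ?thesis using gram by simp
  qed
  have "trace \<sigma> = 1"
    using t0 T by (simp add: trace_def \<sigma> flip: sum_divide_distrib)
  then have "density_matrix \<sigma>"
    by (simp add: density_matrix_def \<sigma>_def pos_semidef_gram)
  moreover have "\<alpha> = dagger \<alpha> ** \<alpha>"
    unfolding \<alpha>_def vec_eq_iff matrix_mul_diag_matrix by (auto simp: diag_matrix_def dagger_def)
  then have "density_matrix \<alpha>"
    using pos_semidef_gram[of \<alpha>]
    by (simp add: density_matrix_def) (simp add: \<alpha>_def trace_def diag_matrix_def if_distrib[of complex_of_real] cong: if_cong)
  ultimately have prod: "tensor \<alpha> \<sigma> \<in> product_states"
    unfolding product_states_def by blast
  have entry: "(tensor \<alpha> \<sigma> ** P) $ (a, l) $ (a, l) =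
      (if a = k then \<Sum>m\<in>UNIV. \<sigma> $ l $ m * P $ (k, m) $ (k, l) else 0)" for a l
  proof -
    have "(tensor \<alpha> \<sigma> ** P) $ (a, l) $ (a, l) =
        (\<Sum>a'\<in>UNIV. \<Sum>m\<in>UNIV. \<alpha> $ a $ a' * \<sigma> $ l $ m * P $ (a', m) $ (a, l))"
      by (simp add: matrix_matrix_mult_def tensor_def sum_UNIV_prod)
    also have "\<dots> = (\<Sum>a'\<in>UNIV. if a' = a then
        (if a = k then \<Sum>m\<in>UNIV. \<sigma> $ l $ m * P $ (k, m) $ (k, l) else 0) else 0)"
      by (rule sum.cong) (auto simp: \<alpha>_def diag_matrix_def)
    finally show ?thesis by simp
  qed
  have "trace (tensor \<alpha> \<sigma> ** P) = (\<Sum>l\<in>UNIV. \<Sum>m\<in>UNIV. \<sigma> $ l $ m * P $ (k, m) $ (k, l))"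
    unfolding trace_def sum_UNIV_prod entry by (subst sum.swap) simp
  \<comment> \<open>With \<open>P $ i $ j = c i * b j\<close>, the column factors of the two entries
    can be exchanged. For the block \<open>Q\<close> this says that the trace of
    \<open>Q ** Q\<close> is the square of the trace of \<open>Q\<close>.\<close>
  also have "\<dots> = (\<Sum>l\<in>UNIV. \<Sum>m\<in>UNIV. P $ (k, l) $ (k, l) * P $ (k, m) $ (k, m)) / complex_of_real (t k)"
    by (simp add: \<sigma> P sum_divide_distrib mult_ac)
  also have "\<dots> = complex_of_real (t k) * complex_of_real (t k) / complex_of_real (t k)"
    by (simp only: T flip: sum_product)
  also have "\<dots> = complex_of_real (t k)" using t0 by simp
  finally show thesis using that[OF prod] k by simp
qed

section \<open>The bound on the entanglement parameter\<close>

theorem proposition4: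
  fixes \<rho> :: "complex ^ ('d::finite \<times> 'd) ^ ('d \<times> 'd)"
  assumes "density_matrix \<rho>"
  shows "entanglement_parameter \<rho> \<le>
           log 2 (real CARD('d)) + (1 - 1 / real CARD('d)) * log 2 (real CARD('d) + 1) - von_neumann_entropy \<rho>"
  unfolding entanglement_parameter_def
proof (rule cSUP_least)
  show "{\<P> :: (complex ^ ('d \<times> 'd) ^ ('d \<times> 'd)) set. von_neumann_measurement \<P>} \<noteq> {}"
    using exists_measurement by auto
next
  fix M :: "(complex ^ ('d \<times> 'd) ^ ('d \<times> 'd)) set"
  assume "M \<in> {\<P>. von_neumann_measurement \<P>}"
  then have M: "von_neumann_measurement M" by simp
  have density: "density_matrix \<delta>" if "\<delta> \<in> product_states" for \<delta> :: "complex ^ ('d \<times> 'd) ^ ('d \<times> 'd)"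
    using that density_matrix_tensor by (auto simp: product_states_def)
  obtain P where P: "P \<in> M" using measurement_nonempty[OF M] .
  then obtain \<delta> where \<delta>: "\<delta> \<in> product_states" "1 / real CARD('d) \<le> Re (trace (\<delta> ** P))"
    using product_state_overlap M unfolding von_neumann_measurement_def by meson
  have "bdd_below ((\<lambda>\<delta>. klein_entropy \<delta> M) ` product_states)"
    using klein_entropy_nonneg[OF density M] by (intro bdd_belowI2[where m = 0])
  then have "(INF \<delta> \<in> product_states. klein_entropy \<delta> M) \<le> klein_entropy \<delta> M"
    using \<delta>(1) by (rule cINF_lower)
  also have "\<dots> \<le> log 2 (real CARD('d)) + (1 - 1 / real CARD('d)) * log 2 (real CARD('d) + 1)"
    \<comment> \<open>The index type \<open>'d \<times> 'd\<close> gives \<open>M\<close> exactly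
      \<open>d * d\<close> outcomes.\<close>
    using P \<delta> card_measurement[OF M] by (intro klein_entropy_le_of_prob[OF density M]) auto
  finally show "(INF \<delta> \<in> product_states. klein_entropy \<delta> M) - klein_entropy \<rho> M \<le>
      log 2 (real CARD('d)) + (1 - 1 / real CARD('d)) * log 2 (real CARD('d) + 1) - von_neumann_entropy \<rho>"
    using von_neumann_entropy_le_klein[OF assms M] by linarith
qed

end
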